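(* For every finite forest $F$ there is a finite monoid $M$ and an element $a\in M$ such that $F$ is isomorphic to $\underline{\mathrm{Cay}}(M,\{a\})$.
   Context: All monoids and graphs are finite and nonempty. For a monoid $M$ and $C\subseteq M$, $\underline{\mathrm{Cay}}(M,C)$ is the simple undirected graph with vertex set $M$ in which distinct $x,y$ are adjacent if and only if $y=xc$ or $x=yc$ for some $c\in C$. *)

theory Defs
  imports "HOL-Algebra.Group" "Graph_Theory.Graph_Theory"
begin

text \<open>
  Simple undirected graphs are rendered by the locale \<^locale>\<open>pair_graph\<close>: finite vertex set,
  irreflexive symmetric arc relation, an edge being a pair of opposite arcs.  The library's
  \<^const>\<open>forest\<close> is about directed cycles, for which an edge traversed back and forth is already a
  cycle, so on symmetric digraphs it only holds of edgeless graphs.  An undirected cycle is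
  therefore a directed one of length at least three.
\<close>

definition undirected_forest :: "'a pair_pre_digraph \<Rightarrow> bool" where
  "undirected_forest F \<longleftrightarrow>
     pair_graph F \<and> pverts F \<noteq> {} \<and>
     \<not> (\<exists>p. pre_digraph.cycle (with_proj F) p \<and> 3 \<le> length p)"

definition cayley_graph :: "('a, 'm) monoid_scheme \<Rightarrow> 'a set \<Rightarrow> 'a pair_pre_digraph" where
  "cayley_graph M C =
     \<lparr>pverts = carrier M,
      parcs = {(x, y). x \<in> carrier M \<and> y \<in> carrier M \<and> x \<noteq> y \<and>
                       (\<exists>c\<in>C. y = x \<otimes>\<^bsub>M\<^esub> c \<or> x = y \<otimes>\<^bsub>M\<^esub> c)}\<rparr>"

lemma pair_graph_cayley_graph:
  assumes "finite (carrier M)"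
  shows "pair_graph (cayley_graph M C)"
proof -
  have "parcs (cayley_graph M C) \<subseteq> carrier M \<times> carrier M"
    by (auto simp: cayley_graph_def)
  then have "finite (parcs (cayley_graph M C))"
    using assms by (meson finite_SigmaI finite_subset)
  moreover have "symmetric (with_proj (cayley_graph M C))"
    by (auto simp: symmetric_def arcs_ends_conv sym_def cayley_graph_def)
  ultimately show ?thesis
    using assms by unfold_locales (auto simp: cayley_graph_def)
qed

text \<open>
  On these graphs the library's \<^const>\<open>digraph_iso\<close> is isomorphism of simple graphs.
\<close>

lemma digraph_iso_pair_graph_iff:
  assumes F: "pair_graph F" and H: "pair_graph H"
  shows "digraph_iso (with_proj F) (with_proj H) \<longleftrightarrow>
    (\<exists>f. bij_betw f (pverts F) (pverts H) \<and>
         (\<forall>x\<in>pverts F. \<forall>y\<in>pverts F. (x, y) \<in> parcs F \<longleftrightarrow> (f x, f y) \<in> parcs H))"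
    (is "?L \<longleftrightarrow> ?R")
proof
  interpret F: pair_graph F by (rule F)
  assume ?L
  then obtain h where h: "pre_digraph.digraph_isomorphism (with_proj F) h"
    and eq: "with_proj H = app_iso h (with_proj F)"
    by (auto simp: digraph_iso_def)
  let ?f = "iso_verts h"
  have V: "pverts H = ?f ` pverts F" and A: "parcs H = iso_arcs h ` parcs F"
    and t: "iso_tail h = fst" and hd: "iso_head h = snd"
    using eq by (auto simp: app_iso_def with_proj_def)
  have inj: "inj_on ?f (pverts F)"
    and ends: "\<And>a. a \<in> parcs F \<Longrightarrow> iso_arcs h a = (?f (fst a), ?f (snd a))"
    using h by (auto simp: pre_digraph.digraph_isomorphism_def t hd prod_eq_iff)
  have "(x, y) \<in> parcs F \<longleftrightarrow> (?f x, ?f y) \<in> parcs H" if "x \<in> pverts F" "y \<in> pverts F" for x y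
  proof
    assume "(x, y) \<in> parcs F"
    then show "(?f x, ?f y) \<in> parcs H" using A ends by force
  next
    assume "(?f x, ?f y) \<in> parcs H"
    then obtain a where a: "a \<in> parcs F" "?f (fst a) = ?f x" "?f (snd a) = ?f y"
      using A ends by auto
    moreover have "fst a \<in> pverts F" "snd a \<in> pverts F"
      using a(1) F.arc_fst_in_verts F.arc_snd_in_verts by auto
    ultimately have "a = (x, y)" using inj that by (auto simp: inj_on_def prod_eq_iff)
    then show "(x, y) \<in> parcs F" using a(1) by simp
  qed
  then show ?R using inj V by (auto simp: bij_betw_def)
next
  interpret F: pair_graph F by (rule F)
  interpret H: pair_graph H by (rule H)
  assume ?R
  then obtain f where f: "bij_betw f (pverts F) (pverts H)"
    and adj: "\<And>x y. x \<in> pverts F \<Longrightarrow> y \<in> pverts F \<Longrightarrow>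
                (x, y) \<in> parcs F \<longleftrightarrow> (f x, f y) \<in> parcs H" by blast
  let ?h = "\<lparr>iso_verts = f, iso_arcs = map_prod f f, iso_head = snd, iso_tail = fst\<rparr>"
  have inj: "inj_on f (pverts F)" and V: "pverts H = f ` pverts F"
    using f by (auto simp: bij_betw_def)
  have sub: "fst a \<in> pverts F \<and> snd a \<in> pverts F" if "a \<in> parcs F" for a
    using that F.arc_fst_in_verts F.arc_snd_in_verts by auto
  have "inj_on (map_prod f f) (parcs F)"
  proof (rule inj_on_subset[OF map_prod_inj_on[OF inj inj]])
    show "parcs F \<subseteq> pverts F \<times> pverts F" using F.wellformed' by auto
  qed
  then have "pre_digraph.digraph_isomorphism (with_proj F) ?h"
    using inj by (auto simp: pre_digraph.digraph_isomorphism_def F.wf_digraph)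
  moreover have "parcs H = map_prod f f ` parcs F"
  proof (intro equalityI subsetI)
    fix b assume b: "b \<in> parcs H"
    then have "fst b \<in> f ` pverts F" "snd b \<in> f ` pverts F"
      using V H.arc_fst_in_verts H.arc_snd_in_verts by auto
    then obtain x y where xy: "x \<in> pverts F" "y \<in> pverts F" "b = (f x, f y)"
      by (metis imageE prod.collapse)
    then have "(x, y) \<in> parcs F" using adj b by blast
    then show "b \<in> map_prod f f ` parcs F" using xy by force
  next
    fix b assume "b \<in> map_prod f f ` parcs F"
    then obtain x y where "(x, y) \<in> parcs F" "b = (f x, f y)" by auto
    then show "b \<in> parcs H" using adj sub[of "(x, y)"] by simp
  qed
  then have "with_proj H = app_iso ?h (with_proj F)"
    using V by (auto simp: app_iso_def with_proj_def)
  ultimately show ?L unfolding digraph_iso_def by blast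
qed

end

theory Submission
  imports Defs
begin

text \<open>
  Root every tree of the forest, let \<open>f\<close> send a vertex to its parent and fix the roots, and let
  \<open>e\<close> be a vertex of maximal depth \<open>t\<close>.  The vertices form a monoid with identity \<open>e\<close> and
  \<open>x \<cdot> y = f\<^bsup>t - depth y\<^esup> x\<close> for \<open>x \<noteq> e\<close>.  Associativity rests on two facts:
  \<open>f\<close> lowers the depth by one, down to zero, and \<open>e\<close> is not a parent when \<open>t > 0\<close>.
  Right multiplication by \<open>f e\<close> is \<open>f\<close>, so its Cayley graph is the forest.
\<close>

text \<open>Take \<open>v\<close> to be the start of a longest path inside \<open>S\<close>. A
  neighbour in \<open>S\<close> other than the next vertex would either prolong the path or close a
  long cycle. If \<open>v\<close> has no neighbour in \<open>S\<close>, the value of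
  \<open>w\<close> is immaterial.\<close>

lemma pair_graph_path_end:
  fixes G (structure)
  assumes "pair_graph G" and S: "S \<subseteq> pverts G" "S \<noteq> {}"
    and acyclic: "\<not> (\<exists>p. pre_digraph.cycle (with_proj G) p \<and> 3 \<le> length p)"
  obtains v w where "v \<in> S" "\<And>x. x \<in> S \<Longrightarrow> (v, x) \<in> parcs G \<Longrightarrow> x = w"
proof -
  interpret pair_graph G by fact
  define P where "P n \<longleftrightarrow> (\<exists>u p v. apath u p v \<and> set (pawalk_verts u p) \<subseteq> S \<and> length p = n)" for n
  obtain s where "s \<in> S" using S by blast
  then have "P 0"
    using S by (auto simp: P_def apath_def awalk_Nil_iff intro!: exI[of _ s] exI[of _ "[]"])
  moreover have "n \<le> card (pverts G)" if "P n" for n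
    using that length_apath by (auto simp: P_def)
  ultimately have "\<exists>n. P n \<and> (\<forall>m. P m \<longrightarrow> m \<le> n)"
    using GreatestI_nat[of P] Greatest_le_nat[of P] by blast
  then obtain u p v where p: "apath u p v" "set (pawalk_verts u p) \<subseteq> S"
    and longest: "\<And>m. P m \<Longrightarrow> m \<le> length p"
    by (auto simp: P_def)
  have aw: "awalk u p v" and dist: "distinct (pawalk_verts u p)"
    using p(1) by (auto simp: apath_def)
  have u: "u \<in> S" using p(2) aw by (cases p) (auto simp: awalk_Cons_iff)
  have "x = snd (hd p)" if x: "x \<in> S" "(u, x) \<in> parcs G" for x
  proof (rule ccontr)
    assume neq: "x \<noteq> snd (hd p)"
    have xu: "(x, u) \<in> parcs G"
      using x(2) arcs_symmetric by blast
    then have "x \<noteq> u" using no_loops' by blast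
    have "x \<in> set (pawalk_verts u p)"
    proof (rule ccontr)
      assume "x \<notin> set (pawalk_verts u p)"
      then have "P (length ((x, u) # p))"
        unfolding P_def using p x xu
        by (intro exI[of _ x] exI[of _ "(x, u) # p"] exI[of _ v]) (auto simp: apath_Cons_iff)
      then show False using longest by fastforce
    qed
    then obtain q r where qr: "p = q @ r" "awalk u q x" "awalk x r v"
      using awalk_decomp[OF aw, of x] by auto
    \<comment> \<open>The stretch \<open>q\<close> of the path from \<open>u\<close> to
      \<open>x\<close> has at least two arcs: it is nonempty since \<open>x \<noteq> u\<close>, and
      a single arc would make \<open>x\<close> the second vertex. Adding \<open>(x, u)\<close> then
      gives a cycle of length at least three.\<close>
    obtain a b q' where q: "q = a # b # q'"
    proof (cases q)
      case Nil
      then show thesis using qr(2) \<open>x \<noteq> u\<close> by (auto simp: awalk_Nil_iff)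
    next
      case (Cons a q1)
      then show thesis using that qr neq
        by (cases q1) (auto simp: awalk_Cons_iff awalk_Nil_iff)
    qed
    have "distinct (pawalk_verts u q)"
      using p(1) qr(1) apath_append_iff by (auto simp: apath_def)
    then have "cycle ((x, u) # q)"
      unfolding cycle_def using xu qr(2) by (auto simp: awalk_Cons_iff)
    moreover have "3 \<le> length ((x, u) # q)" using q by simp
    ultimately show False using acyclic by blast
  qed
  then show thesis using that u by blast
qed

text \<open>Induction on \<open>S\<close> removes a path end \<open>v\<close> and restores it as a
  child of its only neighbour, or as a new root. Letting \<open>S\<close> vary with \<open>G\<close>
  fixed avoids forming subgraphs. Truncated subtraction makes the depth equation cover the roots
  too.\<close>

lemma forest_parent_map:
  assumes "pair_graph G" and S: "S \<subseteq> pverts G"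
    and acyclic: "\<not> (\<exists>p. pre_digraph.cycle (with_proj G) p \<and> 3 \<le> length p)"
  shows "\<exists>f d. (\<forall>x\<in>S. f x \<in> S \<and> d (f x) = d x - (1::nat) \<and> (d x = 0 \<longrightarrow> f x = x)) \<and>
    (\<forall>x\<in>S. \<forall>y\<in>S. (x, y) \<in> parcs G \<longleftrightarrow> x \<noteq> y \<and> (y = f x \<or> x = f y))"
proof -
  interpret pair_graph G by fact
  have "finite S" using S pair_finite_verts finite_subset by blast
  then show ?thesis using S
  proof (induction S rule: finite_psubset_induct)
    case (psubset S)
    show ?case
    proof (cases "S = {}")
      case False
      then obtain v w where v: "v \<in> S" and w: "\<And>x. x \<in> S \<Longrightarrow> (v, x) \<in> parcs G \<Longrightarrow> x = w"
        using pair_graph_path_end[OF assms(1) psubset.prems _ acyclic] by blast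
      let ?T = "S - {v}"
      obtain f d where
        fd: "\<And>x. x \<in> ?T \<Longrightarrow> f x \<in> ?T \<and> d (f x) = d x - (1::nat) \<and> (d x = 0 \<longrightarrow> f x = x)"
        and adj: "\<And>x y. x \<in> ?T \<Longrightarrow> y \<in> ?T \<Longrightarrow>
          (x, y) \<in> parcs G \<longleftrightarrow> x \<noteq> y \<and> (y = f x \<or> x = f y)"
        using psubset.IH[of ?T] psubset.prems v by blast
      have sym: "(x, y) \<in> parcs G \<longleftrightarrow> (y, x) \<in> parcs G" for x y
        using arcs_symmetric by blast
      have irrefl: "(x, x) \<notin> parcs G" for x using no_loops' by blast
      define leaf where "leaf \<longleftrightarrow> w \<in> S \<and> (v, w) \<in> parcs G"
      \<comment> \<open>Since \<open>f\<close> maps \<open>?T\<close> into itself, no old vertex has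
        \<open>v\<close> as parent, so these updates leave the structure on \<open>?T\<close>
        intact.\<close>
      define f' where "f' = f(v := if leaf then w else v)"
      define d' where "d' = d(v := if leaf then Suc (d w) else 0)"
      have "w \<noteq> v" if leaf using that irrefl by (auto simp: leaf_def)
      then have "\<forall>x\<in>S. f' x \<in> S \<and> d' (f' x) = d' x - 1 \<and> (d' x = 0 \<longrightarrow> f' x = x)"
        using fd v by (auto simp: f'_def d'_def leaf_def)
      moreover have vx: "(v, x) \<in> parcs G \<longleftrightarrow> leaf \<and> x = w" if "x \<in> S" for x
        using w that by (auto simp: leaf_def)
      have "(x, y) \<in> parcs G \<longleftrightarrow> x \<noteq> y \<and> (y = f' x \<or> x = f' y)" if xy: "x \<in> S" "y \<in> S" for x y
      proof -
        consider "x = y" | "x = v" "y \<in> ?T" | "x \<in> ?T" "y = v" | "x \<in> ?T" "y \<in> ?T"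
          using xy by blast
        then show ?thesis
        proof cases
          case 1 then show ?thesis using irrefl by simp
        next
          case 2 then show ?thesis using vx[of y] fd[of y] by (auto simp: f'_def)
        next
          case 3 then show ?thesis using vx[of x] fd[of x] sym[of x v] by (auto simp: f'_def)
        next
          case 4 then show ?thesis using adj[of x y] by (auto simp: f'_def)
        qed
      qed
      ultimately show ?thesis by blast
    qed simp
  qed
qed

lemma parent_map_is_right_mult:
  fixes f :: "'a \<Rightarrow> 'a" and d :: "'a \<Rightarrow> nat"
  assumes "finite V" "V \<noteq> {}"
    and closed: "\<And>x. x \<in> V \<Longrightarrow> f x \<in> V"
    and depth: "\<And>x. x \<in> V \<Longrightarrow> d (f x) = d x - 1"
    and root: "\<And>x. x \<in> V \<Longrightarrow> d x = 0 \<Longrightarrow> f x = x"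
  shows "\<exists>(M :: 'a monoid) a. monoid M \<and> carrier M = V \<and> a \<in> V \<and> (\<forall>x\<in>V. x \<otimes>\<^bsub>M\<^esub> a = f x)"
proof -
  have "Max (d ` V) \<in> d ` V" using assms(1,2) by simp
  then obtain e where e: "e \<in> V" "d e = Max (d ` V)" by force
  then have deepest: "d x \<le> d e" if "x \<in> V" for x using assms(1) that by simp
  \<comment> \<open>Without the case split, \<open>e\<close> times \<open>y\<close> would be the
    ancestor of \<open>e\<close> at depth \<open>d y\<close> instead of \<open>y\<close>.\<close>
  define m where "m x y = (if x = e then y else (f ^^ (d e - d y)) x)" for x y
  define M where "M = \<lparr>carrier = V, monoid.mult = m, one = e\<rparr>"
  have iter: "(f ^^ n) x \<in> V \<and> d ((f ^^ n) x) = d x - n" if "x \<in> V" for n x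
    by (induction n) (use that closed depth in auto)
  have sat: "(f ^^ n) x = (f ^^ k) x" if "x \<in> V" "d x \<le> k" "k \<le> n" for n k x
    using \<open>k \<le> n\<close> by (induction n rule: dec_induct) (use that iter root in auto)
  \<comment> \<open>Hence a product \<open>m x y\<close> with \<open>x \<noteq> e\<close> is never
    \<open>e\<close>, so multiplying it further stays in the second branch of
    \<open>m\<close>.\<close>
  have not_parent: "x = e" if "x \<in> V" "(f ^^ n) x = e" for n x
  proof (cases "d e = 0")
    case True
    then show ?thesis using sat[of x 0 n] deepest[of x] that by simp
  next
    case False
    then have "n = 0" using iter[of x n] deepest[of x] that by auto
    then show ?thesis using that by simp
  qed
  have mV: "m x y \<in> V" if "x \<in> V" "y \<in> V" for x y
    using that iter by (simp add: m_def)
  have me: "m x e = x" for x by (simp add: m_def)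
  have assoc: "m (m x y) z = m x (m y z)" if V: "x \<in> V" "y \<in> V" "z \<in> V" for x y z
  proof (cases "x = e \<or> y = e")
    case True
    then show ?thesis by (auto simp: m_def)
  next
    case False
    then have "m (m x y) z = (f ^^ ((d e - d z) + (d e - d y))) x"
      using not_parent[OF V(1)] by (auto simp: m_def funpow_add)
    \<comment> \<open>The inner difference is the depth of \<open>m y z\<close>. If it is not
      truncated, the exponents agree; otherwise both are at least \<open>d e\<close>, and both
      iterates have reached the root above \<open>x\<close>.\<close>
    also have "\<dots> = (f ^^ (d e - (d y - (d e - d z)))) x"
    proof (cases "d e - d z \<le> d y")
      case True
      then show ?thesis using deepest V by (intro arg_cong[where f = "\<lambda>n. (f ^^ n) x"]) simp
    next
      case False
      then show ?thesis using deepest V by (intro sat) auto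
    qed
    also have "\<dots> = m x (m y z)"
      using False iter[OF V(2)] by (simp add: m_def)
    finally show ?thesis .
  qed
  have "monoid M"
    by (rule monoidI) (use e(1) mV me assoc in \<open>auto simp: M_def m_def\<close>)
  \<comment> \<open>For \<open>x \<noteq> e\<close> the exponent is 1 if \<open>d e > 0\<close>; if
    \<open>d e = 0\<close> it is 0, but then every vertex is a root and \<open>f\<close> fixes
    it.\<close>
  moreover have "m x (f e) = f x" if "x \<in> V" for x
    using that deepest[OF that] depth[OF e(1)] root[OF that] root[OF e(1)]
    by (cases "d e") (auto simp: m_def)
  ultimately show ?thesis
    using closed[OF e(1)] by (intro exI[of _ M] exI[of _ "f e"]) (simp add: M_def)
qed

theorem corollary4p4:
  fixes F :: "'a pair_pre_digraph"
  assumes "undirected_forest F"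
  shows "\<exists>(M :: 'a monoid) a. monoid M \<and> finite (carrier M) \<and> a \<in> carrier M \<and>
           digraph_iso (with_proj F) (with_proj (cayley_graph M {a}))"
proof -
  have F: "pair_graph F" and "pverts F \<noteq> {}"
    and acyclic: "\<not> (\<exists>p. pre_digraph.cycle (with_proj F) p \<and> 3 \<le> length p)"
    using assms by (auto simp: undirected_forest_def)
  interpret pair_graph F by (rule F)
  obtain f d where
    fd: "\<forall>x\<in>pverts F. f x \<in> pverts F \<and> d (f x) = d x - (1::nat) \<and> (d x = 0 \<longrightarrow> f x = x)"
    and adj: "\<forall>x\<in>pverts F. \<forall>y\<in>pverts F.
      (x, y) \<in> parcs F \<longleftrightarrow> x \<noteq> y \<and> (y = f x \<or> x = f y)"
    using forest_parent_map[OF F subset_refl acyclic] by (elim exE conjE)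
  have fin: "finite (pverts F)" by (rule pair_finite_verts)
  obtain M :: "'a monoid" and a where M: "monoid M" "carrier M = pverts F" "a \<in> pverts F"
    and mult: "\<forall>x\<in>pverts F. x \<otimes>\<^bsub>M\<^esub> a = f x"
    using parent_map_is_right_mult[of "pverts F" f d] fin \<open>pverts F \<noteq> {}\<close> fd by blast
  have "(x, y) \<in> parcs F \<longleftrightarrow> (x, y) \<in> parcs (cayley_graph M {a})"
    if "x \<in> pverts F" "y \<in> pverts F" for x y
    using that adj mult M(2) by (auto simp: cayley_graph_def)
  moreover have "pverts (cayley_graph M {a}) = pverts F"
    using M(2) by (simp add: cayley_graph_def)
  \<comment> \<open>The carrier is the vertex set itself, so the identity map is the
    isomorphism.\<close>
  ultimately have "digraph_iso (with_proj F) (with_proj (cayley_graph M {a}))"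
    using fin M(2)
    by (subst digraph_iso_pair_graph_iff[OF F pair_graph_cayley_graph]) (auto intro!: exI[of _ id])
  then show ?thesis using M fin by metis
qed

end
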